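(* Let $p$ be an odd prime. Then $D_{Q_p,\mathbf 1}=4$ or $D_{Q_p,\mathbf 1}=5$.
   Context: For an odd prime $p$, $\mathbb Z_p=\mathbb Z/p\mathbb Z$, $U(p)$ is its group of units, and $Q_p=\{x^2:x\in U(p)\}$. A sequence of length $k$ in $\mathbb Z_p$ is an element of $\mathbb Z_p^k$. A sequence $(x_1,\ldots,x_k)$ in $\mathbb Z_p$ is called a $(Q_p,\mathbf 1)$-weighted zero-sum sequence if there exist $a_1,\ldots,a_k\in Q_p$ such that $a_1x_1+\cdots+a_kx_k=0$ and $a_1+\cdots+a_k=0$ in $\mathbb Z_p$. The constant $D_{Q_p,\mathbf 1}$ is the least positive integer $k$ such that every sequence in $\mathbb Z_p$ of length $k$ has a (non-empty) $(Q_p,\mathbf 1)$-weighted zero-sum subsequence (terms not necessarily consecutive). *)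

theory Defs
  imports "HOL-Number_Theory.Residues" "HOL-Library.Sublist"
begin

text \<open>
  \<open>\<int>/p\<int>\<close> is the library's \<^const>\<open>residue_ring\<close>, with carrier \<open>{0..p - 1}\<close>;
  a sequence of length \<open>k\<close> is a list of \<open>k\<close> carrier elements.
\<close>

definition unit_squares :: "nat \<Rightarrow> int set" where
  "unit_squares p = {x \<otimes>\<^bsub>residue_ring (int p)\<^esub> x | x. x \<in> Units (residue_ring (int p))}"

text \<open>\<open>(A, \<one>)\<close>-weighted zero-sum sequences: the weights themselves must also sum to zero.\<close>

definition weighted_zero_sum :: "nat \<Rightarrow> int set \<Rightarrow> int list \<Rightarrow> bool" where
  "weighted_zero_sum n A xs \<longleftrightarrow>
     (\<exists>as. length as = length xs \<and> set as \<subseteq> A \<and>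
       (\<Oplus>\<^bsub>residue_ring (int n)\<^esub>i\<in>{..<length xs}. as ! i \<otimes>\<^bsub>residue_ring (int n)\<^esub> xs ! i)
         = \<zero>\<^bsub>residue_ring (int n)\<^esub> \<and>
       (\<Oplus>\<^bsub>residue_ring (int n)\<^esub>i\<in>{..<length xs}. as ! i) = \<zero>\<^bsub>residue_ring (int n)\<^esub>)"

definition davenport_const :: "nat \<Rightarrow> int set \<Rightarrow> nat" where
  "davenport_const n A =
     (LEAST k. 0 < k \<and>
       (\<forall>xs. length xs = k \<and> set xs \<subseteq> carrier (residue_ring (int n)) \<longrightarrow>
         (\<exists>ys. subseq ys xs \<and> ys \<noteq> [] \<and> weighted_zero_sum n A ys)))"

end

theory Submission
  imports Defs "HOL-Number_Theory.Residue_Primitive_Roots"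
begin

text \<open>
  Writing the weights as \<open>y\<^sub>i\<^sup>2\<close>, a weighted zero-sum subsequence of \<open>x\<^sub>1, \<dots>, x\<^sub>5\<close> is a
  nontrivial common zero of the quadratic forms \<open>\<Sum> x\<^sub>i y\<^sub>i\<^sup>2\<close> and \<open>\<Sum> y\<^sub>i\<^sup>2\<close>: the
  subsequence is given by the support of \<open>y\<close>. Since \<open>5 > 2 + 2\<close>, Chevalley--Warning provides such
  a zero. Conversely, for a quadratic nonresidue \<open>n\<close> the sequence \<open>0, 1, -n\<close> has no weighted
  zero-sum subsequence, because it would exhibit \<open>n\<close> as a quotient of two squares.
\<close>

section \<open>Polynomial functions with a degree bound\<close>

text \<open>Integer polynomial functions of total degree at most \<open>d\<close> in the variables
  \<open>y 0, \<dots>, y (n - 1)\<close>.\<close>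

inductive polyfun :: "nat \<Rightarrow> nat \<Rightarrow> ((nat \<Rightarrow> int) \<Rightarrow> int) \<Rightarrow> bool" for n where
  monomial: "(\<Sum>i<n. e i) \<le> d \<Longrightarrow> polyfun n d (\<lambda>y. c * (\<Prod>i<n. y i ^ e i))"
| add: "polyfun n d f \<Longrightarrow> polyfun n d g \<Longrightarrow> polyfun n d (\<lambda>y. f y + g y)"

lemma polyfun_const: "polyfun n d (\<lambda>y. c)"
  using polyfun.monomial[of "\<lambda>_. 0" n d c] by simp

lemma polyfun_sum:
  assumes "\<And>j. j \<in> J \<Longrightarrow> polyfun n d (f j)"
  shows "polyfun n d (\<lambda>y. \<Sum>j\<in>J. f j y)"
  using assms
  by (induction J rule: infinite_finite_induct) (auto intro: polyfun_const polyfun.add)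

lemma polyfun_mult:
  assumes "polyfun n d f" "polyfun n d' g"
  shows "polyfun n (d + d') (\<lambda>y. f y * g y)"
  using assms
proof (induction rule: polyfun.induct)
  case (monomial e d c)
  from monomial(2,1) show ?case
  proof (induction rule: polyfun.induct)
    case (monomial e' d' c')
    have "polyfun n (d + d') (\<lambda>y. (c * c') * (\<Prod>i<n. y i ^ (e i + e' i)))"
      using monomial by (intro polyfun.monomial) (simp add: sum.distrib)
    then show ?case
      by (simp add: power_add prod.distrib mult_ac)
  next
    case (add d' g h)
    then show ?case
      by (simp add: distrib_left polyfun.add)
  qed
next
  case (add d f h)
  then show ?case
    by (simp add: distrib_right polyfun.add)
qed

lemma polyfun_power:
  assumes "polyfun n d f"
  shows "polyfun n (k * d) (\<lambda>y. f y ^ k)"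
  using assms by (induction k) (auto intro: polyfun_const polyfun_mult)

lemma polyfun_prod:
  assumes "\<And>j. j \<in> J \<Longrightarrow> polyfun n (d j) (f j)"
  shows "polyfun n (\<Sum>j\<in>J. d j) (\<lambda>y. \<Prod>j\<in>J. f j y)"
  using assms
  by (induction J rule: infinite_finite_induct) (auto intro: polyfun_const polyfun_mult)

lemma polyfun_var_power:
  assumes "i < n"
  shows "polyfun n k (\<lambda>y. y i ^ k * c)"
proof -
  have "polyfun n k (\<lambda>y. c * (\<Prod>j<n. y j ^ (if j = i then k else 0)))"
    using assms by (intro polyfun.monomial) simp
  moreover have "(\<Prod>j<n. y j ^ (if j = i then k else 0)) = y i ^ k" for y :: "nat \<Rightarrow> int"
  proof -
    have "(\<Prod>j<n. y j ^ (if j = i then k else 0)) = (\<Prod>j<n. if j = i then y i ^ k else 1)"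
      by (intro prod.cong) auto
    then show ?thesis
      using assms by simp
  qed
  ultimately show ?thesis
    by (simp add: mult.commute)
qed

section \<open>Primitive roots and power sums modulo \<open>p\<close>\<close>

text \<open>Having order exactly \<open>p - 1\<close> is what both uses need: it keeps
  \<open>g ^ k - 1\<close> nonzero modulo \<open>p\<close> for \<open>0 < k < p - 1\<close>, and it
  later makes \<open>g\<close> a nonresidue.\<close>

lemma prime_primroot:
  fixes p :: nat
  assumes "prime p"
  obtains g where "\<And>k. [int g ^ k = 1] (mod int p) \<longleftrightarrow> (p - 1) dvd k"
proof -
  obtain g where g: "residue_primroot p g"
    using prime_primitive_root_exists[OF prime_gt_1_nat[OF assms] assms] by blast
  then have "ord p g = p - 1"
    using assms by (simp add: residue_primroot_def totient_prime)
  then have "[int g ^ k = 1] (mod int p) \<longleftrightarrow> (p - 1) dvd k" for k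
    using ord_divides[of g k p] cong_int_iff[of "g ^ k" 1 p] by simp
  then show ?thesis by (rule that)
qed

text \<open>Multiplication by \<open>g\<close> permutes the residues, so the sum is fixed by multiplication with
  \<open>g ^ k\<close>.\<close>
lemma prime_dvd_power_sum:
  fixes p k :: nat
  assumes p: "prime p" and k: "k < p - 1"
  shows "int p dvd (\<Sum>x\<in>{0..<int p}. x ^ k)"
proof (cases "k = 0")
  \<comment> \<open>Here \<open>0 ^ 0 = 1\<close>, so the sum equals \<open>p\<close>.\<close>
  case True
  then show ?thesis by simp
next
  case False
  obtain g where g: "\<And>k. [int g ^ k = 1] (mod int p) \<longleftrightarrow> (p - 1) dvd k"
    using prime_primroot[OF p] by metis
  \<comment> \<open>The power \<open>g ^ (p - 1)\<close> is 1 modulo \<open>p\<close>, so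
    \<open>g\<close> is a unit.\<close>
  have "coprime (int g) (int p)"
    using g[of "p - 1"] k False by (metis cong_imp_coprime cong_sym coprime_1_left coprime_power_left_iff dvd_refl gr_zeroI less_zeroE)
  let ?S = "\<Sum>x\<in>{0..<int p}. x ^ k"
  have inj: "inj_on (\<lambda>x. int g * x mod int p) {0..<int p}"
  proof (rule inj_onI)
    fix x y assume "x \<in> {0..<int p}" "y \<in> {0..<int p}" "int g * x mod int p = int g * y mod int p"
    then show "x = y"
      using \<open>coprime (int g) (int p)\<close> cong_mult_lcancel[of "int g" "int p" x y]
      by (auto simp: cong_def)
  qed
  moreover have "(\<lambda>x. int g * x mod int p) ` {0..<int p} \<subseteq> {0..<int p}"
    using p prime_gt_0_nat by auto
  ultimately have img: "(\<lambda>x. int g * x mod int p) ` {0..<int p} = {0..<int p}"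
    by (simp add: endo_inj_surj)
  have "?S = (\<Sum>x\<in>{0..<int p}. (int g * x mod int p) ^ k)"
    by (subst img[symmetric], subst sum.reindex[OF inj]) simp
  also have "[\<dots> = (\<Sum>x\<in>{0..<int p}. (int g * x) ^ k)] (mod int p)"
    by (intro cong_sum cong_pow) simp
  also have "(\<Sum>x\<in>{0..<int p}. (int g * x) ^ k) = int g ^ k * ?S"
    by (simp add: power_mult_distrib sum_distrib_left)
  finally have "int p dvd (int g ^ k - 1) * ?S"
    by (simp add: cong_iff_dvd_diff algebra_simps dvd_diff_commute)
  moreover have "\<not> int p dvd int g ^ k - 1"
    using g[of k] k False by (simp add: cong_iff_dvd_diff nat_dvd_not_less)
  ultimately show ?thesis
    using p by (simp add: prime_dvd_mult_iff)
qed

section \<open>The Chevalley--Warning theorem\<close>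

text \<open>Over the box, the sum of a monomial factors into one-variable power sums. The degree
  bound forces some exponent below \<open>p - 1\<close>, and the factor with that exponent vanishes
  modulo \<open>p\<close>.\<close>

lemma prime_dvd_polyfun_sum:
  fixes p :: nat
  assumes p: "prime p" and "polyfun n d f" "d < n * (p - 1)"
  shows "int p dvd (\<Sum>y\<in>PiE {..<n} (\<lambda>_. {0..<int p}). f y)"
  using assms(2,3)
proof (induction rule: polyfun.induct)
  case (monomial e d c)
  have "\<exists>i<n. e i < p - 1"
  proof (rule ccontr)
    assume "\<not> ?thesis"
    then have "(\<Sum>i<n. p - 1) \<le> (\<Sum>i<n. e i)"
      by (intro sum_mono) auto
    then show False
      using monomial by simp
  qed
  then obtain i where "i < n" "e i < p - 1" by auto
  then have "int p dvd (\<Prod>i<n. \<Sum>x\<in>{0..<int p}. x ^ e i)"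
    using prime_dvd_power_sum[OF p, of "e i"]
      dvd_prodI[of "{..<n}" i "\<lambda>i. \<Sum>x\<in>{0..<int p}. x ^ e i"]
    by (auto intro: dvd_trans)
  then show ?case
    by (simp add: prod_sum_PiE flip: sum_distrib_left)
next
  case (add d f g)
  then show ?case
    by (simp add: sum.distrib)
qed

lemma fermat_theorem_int:
  fixes p :: nat
  assumes "prime p" "\<not> int p dvd a"
  shows "[a ^ (p - 1) = 1] (mod int p)"
proof -
  interpret residues_prime p "residue_ring (int p)"
    using assms by unfold_locales simp_all
  show ?thesis
    using euler_theorem[of a] assms by (simp add: p_coprime_right_int totient_prime)
qed

text \<open>By Fermat, the product of the factors \<open>1 - f j y ^ (p - 1)\<close> is modulo
  \<open>p\<close> the indicator of the common zeros. Its sum over the box thus counts these zeros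
  modulo \<open>p\<close>, and its degree is small enough for that sum to vanish.\<close>

theorem chevalley_warning:
  fixes p :: nat
  assumes p: "prime p" and "finite J" and f: "\<And>j. j \<in> J \<Longrightarrow> polyfun n (d j) (f j)"
    and d: "(\<Sum>j\<in>J. d j) < n"
  shows "p dvd card {y \<in> PiE {..<n} (\<lambda>_. {0..<int p}). \<forall>j\<in>J. int p dvd f j y}"
proof -
  let ?P = "PiE {..<n} (\<lambda>_. {0..<int p})"
  \<comment> \<open>The difference is written as a sum with a constant multiple, to fit the closure
    rules of \<open>polyfun\<close>.\<close>
  let ?ind = "\<lambda>y. \<Prod>j\<in>J. 1 + (- 1) * f j y ^ (p - 1)"
  have "polyfun n (\<Sum>j\<in>J. (p - 1) * d j) ?ind"
    by (intro polyfun_prod polyfun.add polyfun_const polyfun_power f)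
      (rule polyfun_mult[of n 0, simplified], (intro polyfun_const polyfun_power f; simp)+)
  moreover have "(\<Sum>j\<in>J. (p - 1) * d j) < n * (p - 1)"
    using d prime_gt_1_nat[OF p] by (simp flip: sum_distrib_left)
  ultimately have "int p dvd (\<Sum>y\<in>?P. ?ind y)"
    by (rule prime_dvd_polyfun_sum[OF p])
  moreover have "[?ind y = (if \<forall>j\<in>J. int p dvd f j y then 1 else 0)] (mod int p)" for y
  proof (cases "\<forall>j\<in>J. int p dvd f j y")
    case True
    have "[?ind y = (\<Prod>j\<in>J. 1)] (mod int p)"
      using True prime_gt_1_nat[OF p]
      by (intro cong_prod) (simp add: cong_iff_dvd_diff prime_dvd_power_iff p)
    with True show ?thesis by simp
  next
    case False
    then obtain j where j: "j \<in> J" "\<not> int p dvd f j y" by auto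
    then have "[f j y ^ (p - 1) = 1] (mod int p)"
      by (intro fermat_theorem_int p)
    then have "int p dvd 1 + (- 1) * f j y ^ (p - 1)"
      by (simp add: cong_iff_dvd_diff dvd_diff_commute)
    then have "int p dvd ?ind y"
      using j \<open>finite J\<close> dvd_prodI dvd_trans by metis
    with False show ?thesis
      by (auto simp: cong_iff_dvd_diff)
  qed
  then have "[(\<Sum>y\<in>?P. ?ind y) = (\<Sum>y\<in>?P. if \<forall>j\<in>J. int p dvd f j y then 1 else 0)] (mod int p)"
    by (intro cong_sum)
  moreover have "finite ?P"
    by (intro finite_PiE) auto
  then have "(\<Sum>y\<in>?P. if \<forall>j\<in>J. int p dvd f j y then 1 else 0 :: int) =
    int (card {y \<in> ?P. \<forall>j\<in>J. int p dvd f j y})"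
    by (simp flip: sum.inter_filter)
  ultimately show ?thesis
    using cong_dvd_iff by fastforce
qed

section \<open>From weights to quadratic forms\<close>

text \<open>Each weight is traded for a square root of it, and the ring equations become integer
  divisibility. Pairing a term with its root keeps the two together when entries are filtered
  out.\<close>

lemma weighted_zero_sum_unit_squares_iff:
  assumes "prime p"
  shows "weighted_zero_sum p (unit_squares p) xs \<longleftrightarrow>
    (\<exists>zs. map fst zs = xs \<and> (\<forall>z\<in>set zs. \<not> int p dvd snd z) \<and>
      int p dvd (\<Sum>z\<leftarrow>zs. (snd z)\<^sup>2 * fst z) \<and> int p dvd (\<Sum>z\<leftarrow>zs. (snd z)\<^sup>2))"
  (is "_ = (\<exists>zs. ?P zs)")
proof -
  interpret residues_prime p "residue_ring (int p)"
    using assms by unfold_locales simp_all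
  let ?R = "residue_ring (int p)"
  have usq: "a \<in> unit_squares p \<longleftrightarrow> (\<exists>x. \<not> int p dvd x \<and> a = x\<^sup>2 mod int p)" for a
  proof
    assume "a \<in> unit_squares p"
    then show "\<exists>x. \<not> int p dvd x \<and> a = x\<^sup>2 mod int p"
      unfolding unit_squares_def
      by (auto simp: res_units_eq res_mult_eq p_coprime_right_int power2_eq_square)
  next
    assume "\<exists>x. \<not> int p dvd x \<and> a = x\<^sup>2 mod int p"
    then obtain x where x: "\<not> int p dvd x" "a = x\<^sup>2 mod int p" by auto
    then have "x mod int p \<in> Units ?R"
      using m_gt_one by (intro mod_in_res_units) (auto simp: p_coprime_right_int)
    with x show "a \<in> unit_squares p"
      unfolding unit_squares_def by (force simp: mult_cong power2_eq_square)
  qed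
  have fin1: "(\<Oplus>\<^bsub>?R\<^esub>i\<in>{..<length zs}. map (\<lambda>z. (snd z)\<^sup>2 mod int p) zs ! i \<otimes>\<^bsub>?R\<^esub> map fst zs ! i)
      = (\<Sum>z\<leftarrow>zs. (snd z)\<^sup>2 * fst z) mod int p" for zs :: "(int \<times> int) list"
  proof -
    have "(\<Oplus>\<^bsub>?R\<^esub>i\<in>{..<length zs}. map (\<lambda>z. (snd z)\<^sup>2 mod int p) zs ! i \<otimes>\<^bsub>?R\<^esub> map fst zs ! i)
      = (\<Oplus>\<^bsub>?R\<^esub>i\<in>{..<length zs}. ((snd (zs ! i))\<^sup>2 * fst (zs ! i)) mod int p)"
      by (intro finsum_cong') (auto simp: res_mult_eq mod_simps)
    also have "\<dots> = (\<Sum>i<length zs. (snd (zs ! i))\<^sup>2 * fst (zs ! i)) mod int p"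
      by (rule sum_cong) simp
    finally show ?thesis
      by (simp add: sum_list_sum_nth atLeast0LessThan)
  qed
  have fin2: "(\<Oplus>\<^bsub>?R\<^esub>i\<in>{..<length zs}. map (\<lambda>z. (snd z)\<^sup>2 mod int p) zs ! i)
      = (\<Sum>z\<leftarrow>zs. (snd z)\<^sup>2) mod int p" for zs :: "(int \<times> int) list"
  proof -
    have "(\<Oplus>\<^bsub>?R\<^esub>i\<in>{..<length zs}. map (\<lambda>z. (snd z)\<^sup>2 mod int p) zs ! i)
      = (\<Oplus>\<^bsub>?R\<^esub>i\<in>{..<length zs}. (snd (zs ! i))\<^sup>2 mod int p)"
      by (intro finsum_cong') auto
    also have "\<dots> = (\<Sum>i<length zs. (snd (zs ! i))\<^sup>2) mod int p"
      by (rule sum_cong) simp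
    finally show ?thesis
      by (simp add: sum_list_sum_nth atLeast0LessThan)
  qed
  show ?thesis
  proof
    assume "weighted_zero_sum p (unit_squares p) xs"
    then obtain as where as: "length as = length xs" "set as \<subseteq> unit_squares p"
      "(\<Oplus>\<^bsub>?R\<^esub>i\<in>{..<length xs}. as ! i \<otimes>\<^bsub>?R\<^esub> xs ! i) = \<zero>\<^bsub>?R\<^esub>"
      "(\<Oplus>\<^bsub>?R\<^esub>i\<in>{..<length xs}. as ! i) = \<zero>\<^bsub>?R\<^esub>"
      unfolding weighted_zero_sum_def by blast
    \<comment> \<open>The root is chosen per weight, not per position, so equal weights share a
      root.\<close>
    from as(2) obtain r where r: "\<And>a. a \<in> set as \<Longrightarrow> \<not> int p dvd r a \<and> a = (r a)\<^sup>2 mod int p"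
      using usq by (metis (no_types, lifting) subsetD)
    define zs where "zs = zip xs (map r as)"
    have fst: "map fst zs = xs" and snd: "map snd zs = map r as"
      using as(1) by (simp_all add: zs_def)
    have "map (\<lambda>z. (snd z)\<^sup>2 mod int p) zs = map (\<lambda>y. y\<^sup>2 mod int p) (map r as)"
      by (simp flip: snd)
    also have "\<dots> = as"
      using r by (simp add: map_idI)
    finally have as_eq: "map (\<lambda>z. (snd z)\<^sup>2 mod int p) zs = as" .
    have len: "length xs = length zs" using fst by auto
    have "\<forall>z\<in>set zs. \<not> int p dvd snd z"
      using r by (auto simp: zs_def dest!: set_zip_rightD)
    then have "?P zs"
      using as(3,4) fst fin1[of zs] fin2[of zs] by (simp add: as_eq len res_zero_eq dvd_eq_mod_eq_0)
    then show "\<exists>zs. ?P zs" ..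
  next
    assume "\<exists>zs. ?P zs"
    then obtain zs where zs: "?P zs" ..
    have "length xs = length zs" using zs by auto
    show "weighted_zero_sum p (unit_squares p) xs"
      unfolding weighted_zero_sum_def
    proof (intro exI conjI)
      let ?as = "map (\<lambda>z. (snd z)\<^sup>2 mod int p) zs"
      show "length ?as = length xs"
        using \<open>length xs = length zs\<close> by simp
      show "set ?as \<subseteq> unit_squares p"
        using zs usq by auto
      show "(\<Oplus>\<^bsub>?R\<^esub>i\<in>{..<length xs}. ?as ! i \<otimes>\<^bsub>?R\<^esub> xs ! i) = \<zero>\<^bsub>?R\<^esub>"
        using zs fin1[of zs] unfolding \<open>length xs = length zs\<close>
        by (metis dvd_eq_mod_eq_0 res_zero_eq)
      show "(\<Oplus>\<^bsub>?R\<^esub>i\<in>{..<length xs}. ?as ! i) = \<zero>\<^bsub>?R\<^esub>"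
        using zs fin2[of zs] unfolding \<open>length xs = length zs\<close>
        by (metis dvd_eq_mod_eq_0 res_zero_eq)
    qed
  qed
qed

section \<open>The upper bound 5\<close>

lemma exists_weighted_zero_sum_subseq:
  fixes p :: nat
  assumes p: "prime p" and len: "length xs \<ge> 5"
  shows "\<exists>ys. subseq ys xs \<and> ys \<noteq> [] \<and> weighted_zero_sum p (unit_squares p) ys"
proof -
  let ?n = "length xs"
  \<comment> \<open>The Boolean index joins both forms in one family: \<open>True\<close> gives the
    weighted form, \<open>False\<close> the sum of squares. The total degree is 4, below
    \<open>length xs\<close>.\<close>
  define f where "f b y = (\<Sum>i<?n. y i ^ 2 * (if b then xs ! i else 1))" for b and y :: "nat \<Rightarrow> int"
  let ?Z = "{y \<in> PiE {..<?n} (\<lambda>_. {0..<int p}). \<forall>b\<in>UNIV. int p dvd f b y}"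
  have "p dvd card ?Z"
  proof (rule chevalley_warning[OF p])
    show "polyfun ?n 2 (f b)" for b
      unfolding f_def by (intro polyfun_sum polyfun_var_power) simp
  qed (use len in \<open>auto simp: UNIV_bool\<close>)
  \<comment> \<open>The trivial zero, restricted because members of \<open>PiE\<close> are
    \<open>undefined\<close> outside the index set.\<close>
  define z where "z = (\<lambda>i\<in>{..<?n}. 0 :: int)"
  have "z \<in> ?Z"
    using prime_gt_0_nat[OF p] by (auto simp: z_def f_def)
  have "?Z \<noteq> {z}"
  proof
    assume "?Z = {z}"
    then have "card ?Z = 1" by simp
    with \<open>p dvd card ?Z\<close> p show False by simp
  qed
  with \<open>z \<in> ?Z\<close> obtain y where y: "y \<in> ?Z" "y \<noteq> z" by blast
  have yr: "0 \<le> y i \<and> y i < int p" if "i < ?n" for i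
    using y(1) that by auto
  have "\<exists>i<?n. y i \<noteq> 0"
  proof (rule ccontr)
    assume "\<not> ?thesis"
    then have "y = z"
      using y(1) by (intro ext) (auto simp: z_def PiE_def extensional_def)
    with y(2) show False ..
  qed
  then obtain i where i: "i < ?n" "y i \<noteq> 0" by blast
  define zs where "zs = map (\<lambda>i. (xs ! i, y i)) [0..<?n]"
  \<comment> \<open>Entries with root 0 contribute to neither form; the remaining roots lie strictly
    between 0 and \<open>p\<close>.\<close>
  define ws where "ws = filter (\<lambda>z. snd z \<noteq> 0) zs"
  have "map fst zs = xs"
    by (simp add: zs_def comp_def map_nth)
  then have "subseq (map fst ws) xs"
    unfolding ws_def by (metis subseq_map subseq_filter_left)
  moreover have "(xs ! i, y i) \<in> set ws"
    using i by (auto simp: ws_def zs_def)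
  then have "map fst ws \<noteq> []" by auto
  moreover have "weighted_zero_sum p (unit_squares p) (map fst ws)"
  proof -
    have "\<not> int p dvd snd z" if "z \<in> set ws" for z
      using that yr by (auto simp: ws_def zs_def zdvd_not_zless less_le)
    moreover have "(\<Sum>z\<leftarrow>ws. (snd z)\<^sup>2 * fst z) = f True y"
      unfolding ws_def f_def by (subst sum_list_map_filter)
        (auto simp: zs_def comp_def interv_sum_list_conv_sum_set_nat atLeast0LessThan)
    moreover have "(\<Sum>z\<leftarrow>ws. (snd z)\<^sup>2) = f False y"
      unfolding ws_def f_def by (subst sum_list_map_filter)
        (auto simp: zs_def comp_def interv_sum_list_conv_sum_set_nat atLeast0LessThan)
    ultimately show ?thesis
      using y(1) unfolding weighted_zero_sum_unit_squares_iff[OF p] by (intro exI[of _ ws]) simp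
  qed
  ultimately show ?thesis by blast
qed

section \<open>The lower bound 4\<close>

text \<open>A primitive root is a nonresidue: if \<open>g\<close> were \<open>y\<^sup>2\<close>,
  then \<open>g ^ ((p - 1) div 2)\<close> would be \<open>y ^ (p - 1) = 1\<close>, contradicting its
  order.\<close>

lemma exists_nonresidue:
  fixes p :: nat
  assumes p: "prime p" "odd p"
  obtains n where "\<not> QuadRes (int p) n"
proof -
  obtain g where g: "\<And>k. [int g ^ k = 1] (mod int p) \<longleftrightarrow> (p - 1) dvd k"
    using prime_primroot[OF p(1)] by metis
  have "\<not> QuadRes (int p) (int g)"
  proof
    assume "QuadRes (int p) (int g)"
    then obtain y where y: "[y\<^sup>2 = int g] (mod int p)"
      by (auto simp: QuadRes_def)
    have "p > 2"
      using p prime_gt_1_nat[of p] by (cases "p = 2") auto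
    \<comment> \<open>\<open>QuadRes\<close> also holds for multiples of \<open>p\<close>, so this
      case is excluded before Fermat is applied to \<open>y\<close>.\<close>
    have "\<not> int p dvd int g"
    proof
      assume "int p dvd int g"
      then have "[int g ^ (p - 1) = 0] (mod int p)"
        using \<open>p > 2\<close> by (simp add: cong_0_iff prime_dvd_power_iff p)
      with g[of "p - 1"] have "[0 = 1 :: int] (mod int p)"
        by (simp add: cong_def)
      with \<open>p > 2\<close> show False
        by (simp add: cong_iff_dvd_diff zdvd_not_zless)
    qed
    with y have "\<not> int p dvd y"
      by (metis cong_dvd_iff dvd_mult2 power2_eq_square)
    have "[int g ^ ((p - 1) div 2) = (y\<^sup>2) ^ ((p - 1) div 2)] (mod int p)"
      using y by (intro cong_pow) (rule cong_sym)
    also have "(y\<^sup>2) ^ ((p - 1) div 2) = y ^ (p - 1)"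
      using p(2) by (simp flip: power_mult)
    also have "[y ^ (p - 1) = 1] (mod int p)"
      using p(1) \<open>\<not> int p dvd y\<close> by (rule fermat_theorem_int)
    finally show False
      using g[of "(p - 1) div 2"] \<open>p > 2\<close> by (simp add: nat_dvd_not_less)
  qed
  then show ?thesis by (rule that)
qed

text \<open>If \<open>1\<close> and \<open>- n\<close> both occur, the weighted sum gives
  \<open>a\<^sup>2 = b\<^sup>2 * n\<close> modulo \<open>p\<close>. If just one of them occurs, a
  product of units would vanish, since \<open>n\<close> is nonzero modulo \<open>p\<close>. The
  sequence \<open>[0]\<close> fails because its single weight is nonzero.\<close>

lemma no_weighted_zero_sum_subseq:
  fixes p :: nat
  assumes p: "prime p" and n: "\<not> QuadRes (int p) n"
    and ys: "subseq ys [0, 1, - n mod int p]" "ys \<noteq> []"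
  shows "\<not> weighted_zero_sum p (unit_squares p) ys"
proof
  \<comment> \<open>Multiplying by the squared inverse of \<open>b\<close> exhibits \<open>n\<close>
    as a square. The choice \<open>a = 0\<close> covers the case that \<open>p\<close> divides
    \<open>b\<^sup>2 * n\<close>.\<close>
  have sq: False if "\<not> int p dvd b" "int p dvd a\<^sup>2 - b\<^sup>2 * n" for a b
  proof -
    have "coprime b (int p)"
      using that(1) p by (metis coprime_commute prime_imp_coprime prime_nat_int_transfer)
    then obtain c where "[b * c = 1] (mod int p)"
      using cong_solve_coprime_int by blast
    have "[(a * c)\<^sup>2 = (b * c)\<^sup>2 * n] (mod int p)"
      using dvd_mult2[OF that(2), of "c\<^sup>2"]
      by (simp add: cong_iff_dvd_diff power_mult_distrib algebra_simps)
    also have "[(b * c)\<^sup>2 * n = 1\<^sup>2 * n] (mod int p)"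
      by (intro cong_mult cong_pow cong_refl) fact
    finally show False
      using n by (auto simp: QuadRes_def)
  qed
  \<comment> \<open>The last entry was reduced to lie in the carrier; divisibility does not see the
    reduction.\<close>
  have t: "int p dvd u + v * (- n mod int p) \<longleftrightarrow> int p dvd u - v * n" for u v
  proof (rule cong_dvd_iff)
    have "[u + v * (- n mod int p) = u + v * (- n)] (mod int p)"
      by (intro cong_add cong_mult cong_refl) simp
    then show "[u + v * (- n mod int p) = u - v * n] (mod int p)"
      by simp
  qed
  assume "weighted_zero_sum p (unit_squares p) ys"
  then obtain zs where "map fst zs = ys" "\<forall>z\<in>set zs. \<not> int p dvd snd z"
    "int p dvd (\<Sum>z\<leftarrow>zs. (snd z)\<^sup>2 * fst z)" "int p dvd (\<Sum>z\<leftarrow>zs. (snd z)\<^sup>2)"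
    unfolding weighted_zero_sum_unit_squares_iff[OF p] by auto
  moreover have "ys \<in> {[0], [1], [- n mod int p], [0, 1], [0, - n mod int p],
      [1, - n mod int p], [0, 1, - n mod int p]}"
    using ys unfolding in_set_subseqs[symmetric] by (auto simp: Let_def)
  ultimately show False
    using p sq[of _ 0] sq
    by (auto simp: prime_dvd_power_iff map_eq_Cons_conv t add.commute t[of 0, simplified])
qed

theorem theorem4p2:
  fixes p :: nat
  assumes "prime p" and "odd p"
  shows "davenport_const p (unit_squares p) = 4 \<or> davenport_const p (unit_squares p) = 5"
proof -
  define P where "P k \<longleftrightarrow> 0 < k \<and>
       (\<forall>xs. length xs = k \<and> set xs \<subseteq> carrier (residue_ring (int p)) \<longrightarrow>
         (\<exists>ys. subseq ys xs \<and> ys \<noteq> [] \<and> weighted_zero_sum p (unit_squares p) ys))" for k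
  have const: "davenport_const p (unit_squares p) = (LEAST k. P k)"
    unfolding davenport_const_def P_def ..
  have "P 5"
    unfolding P_def using exists_weighted_zero_sum_subseq[OF assms(1)] by simp
  then have le: "davenport_const p (unit_squares p) \<le> 5" and P: "P (davenport_const p (unit_squares p))"
    unfolding const by (rule Least_le, rule LeastI)
  \<comment> \<open>Every prefix of the bad sequence is bad, so one example of length 3 excludes all
    shorter lengths too.\<close>
  have "\<not> P k" if "k \<le> 3" for k
  proof
    assume "P k"
    obtain n where n: "\<not> QuadRes (int p) n"
      using exists_nonresidue[OF assms] .
    let ?xs = "[0, 1, - n mod int p]"
    have "set ?xs \<subseteq> carrier (residue_ring (int p))"
      using prime_gt_1_nat[OF assms(1)] by (simp add: residue_ring_def zle_diff1_eq)
    then have "length (take k ?xs) = k" "set (take k ?xs) \<subseteq> carrier (residue_ring (int p))"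
      using that set_take_subset[of k ?xs] by (auto simp del: take_Cons)
    then obtain ys where "subseq ys (take k ?xs)" "ys \<noteq> []" "weighted_zero_sum p (unit_squares p) ys"
      using \<open>P k\<close> unfolding P_def by blast
    moreover have "subseq ys ?xs"
      using \<open>subseq ys (take k ?xs)\<close> by (metis append_take_drop_id subseq_rev_drop_many)
    ultimately show False
      using no_weighted_zero_sum_subseq[OF assms(1) n] by blast
  qed
  then have "davenport_const p (unit_squares p) > 3"
    using P by (meson leI)
  with le show ?thesis by linarith
qed

end
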